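(* Let $\mathfrak g$ be an $n$-Lie algebra and let $E=\mathfrak g\oplus V$ be a vector space containing $\mathfrak g$ with fixed complement $V$. Let $\mathfrak T_n^{\mathrm{full}}(\mathfrak g,V)$ be the set of all full extending structures of $\mathfrak g$ through $V$. There are canonical bijections $$\mathfrak T_n^{\mathrm{full}}(\mathfrak g,V)/{\equiv}\;\longrightarrow\;\mathrm{Extd}_n(E,\mathfrak g),\qquad\mathfrak T_n^{\mathrm{full}}(\mathfrak g,V)/{\approx}\;\longrightarrow\;\mathrm{Extd}'_n(E,\mathfrak g),$$ both sending the class of $\boldsymbol\Gamma$ to the class of $\mathfrak g\natural^{\mathrm{full}}_{\boldsymbol\Gamma}V$.
   Context: $K$ is a field of characteristic zero; vector spaces are over $K$, all maps are linear; $n\ge2$. An $n$-Lie algebra is a vector space with an alternating $n$-linear bracket satisfying the Filippov identity $[z_1,\dots,z_{n-1},[w_1,\dots,w_n]]=\sum_{i=1}^n[w_1,\dots,w_{i-1},[z_1,\dots,z_{n-1},w_i],w_{i+1},\dots,w_n]$. An extending bracket is an $n$-Lie bracket on $E$ whose restriction to $\mathfrak g$ is the given bracket. $\mathrm{Extd}_n(E,\mathfrak g)$ is the set of extending brackets modulo $n$-Lie algebra isomorphisms fixing $\mathfrak g$ pointwise; $\mathrm{Extd}'_n(E,\mathfrak g)$ is the finer quotient by isomorphisms which fix $\mathfrak g$ pointwise and also induce the identity on $E/\mathfrak g$. A full extending datum of $\mathfrak g$ through $V$ is a family $\boldsymbol\Gamma=((\Gamma_k^{\mathfrak g},\Gamma_k^V))_{1\le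 k\le n}$ of linear maps $\Gamma_k^{\mathfrak g}:\bigwedge^kV\otimes\bigwedge^{n-k}\mathfrak g\to\mathfrak g$ and $\Gamma_k^V:\bigwedge^kV\otimes\bigwedge^{n-k}\mathfrak g\to V$, together with the convention $\Gamma_0^{\mathfrak g}(x_1,\dots,x_n)=[x_1,\dots,x_n]_{\mathfrak g}$, $\Gamma_0^V=0$. For $x_i\in\mathfrak g$, $u_i\in V$ put $$\mathcal G_{\boldsymbol\Gamma}(x_1,u_1;\dots;x_n,u_n)=\sum_{k=0}^n\ \sum_{1\le i_1<\dots<i_k\le n}(-1)^{i_1+\dots+i_k-k(k+1)/2}\,\Gamma_k^{\mathfrak g}(u_{i_1},\dots,u_{i_k};x_{j_1},\dots,x_{j_{n-k}}),$$ and $\mathcal H_{\boldsymbol\Gamma}$ by the same formula with $\Gamma_k^V$ in place of $\Gamma_k^{\mathfrak g}$, where $j_1<\dots<j_{n-k}$ are the complementary indices in $\{1,\dots,n\}$. $\boldsymbol\Gamma$ is a full extending structure if the operation $[x_1+u_1,\dots,x_n+u_n]_{\boldsymbol\Gamma}=\mathcal G_{\boldsymbol\Gamma}(x_1,u_1;\dots;x_n,u_n)+\mathcal H_{\boldsymbol\Gamma}(x_1,u_1;\dots;x_n,u_n)$ on $\mathfrak g\oplus V$ satisfies the Filippov identity; the resulting $n$-Lie algebra is denoted $\mathfrak g\natural^{\mathrm{full}}_{\boldsymbol\Gamma}V$. For full extending structures $\boldsymbol\Gamma,\boldsymbol\Lambda$, write $\boldsymbol\Gamma\equiv\boldsymbol\Lambda$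 if there exist linear $r:V\to\mathfrak g$ and $s\in\mathrm{GL}(V)$ such that for all $x_i\in\mathfrak g$, $u_i\in V$ $$\mathcal G_{\boldsymbol\Gamma}(x_1,u_1;\dots;x_n,u_n)+r(\mathcal H_{\boldsymbol\Gamma}(x_1,u_1;\dots;x_n,u_n))=\mathcal G_{\boldsymbol\Lambda}(x_1+r(u_1),s(u_1);\dots;x_n+r(u_n),s(u_n)),$$ $$s(\mathcal H_{\boldsymbol\Gamma}(x_1,u_1;\dots;x_n,u_n))=\mathcal H_{\boldsymbol\Lambda}(x_1+r(u_1),s(u_1);\dots;x_n+r(u_n),s(u_n)).$$ Write $\boldsymbol\Gamma\approx\boldsymbol\Lambda$ if these hold for some $r$ with $s=\mathrm{id}_V$. *)

theory Defs
  imports Complex_Main "HOL-Library.FuncSet" "HOL-Library.Product_Plus"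
begin

text \<open>
  Vector spaces over the field \<open>'k\<close> are types with a scalar multiplication satisfying the
  library predicate \<^const>\<open>vector_space\<close>. An \<open>m\<close>-tuple is a list of length \<open>m\<close>, so an operation
  of arity \<open>m\<close> is a function on lists of which only the values on lists of length \<open>m\<close> matter.
\<close>

definition alt_multilinear ::
  "('k::field \<Rightarrow> 'a::ab_group_add \<Rightarrow> 'a) \<Rightarrow> ('k \<Rightarrow> 'b::ab_group_add \<Rightarrow> 'b) \<Rightarrow> nat \<Rightarrow> ('a list \<Rightarrow> 'b) \<Rightarrow> bool"
where
  "alt_multilinear s t m f \<longleftrightarrow>
     (\<forall>xs i. length xs = m \<longrightarrow> i < m \<longrightarrow> Vector_Spaces.linear s t (\<lambda>y. f (xs[i := y]))) \<and>
     (\<forall>xs i j. length xs = m \<longrightarrow> i < j \<longrightarrow> j < m \<longrightarrow> xs ! i = xs ! j \<longrightarrow> f xs = 0)"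

definition filippov :: "nat \<Rightarrow> ('a::ab_group_add list \<Rightarrow> 'a) \<Rightarrow> bool" where
  "filippov n b \<longleftrightarrow>
     (\<forall>zs ws. length zs = n - 1 \<longrightarrow> length ws = n \<longrightarrow>
        b (zs @ [b ws]) = (\<Sum>i<n. b (ws[i := b (zs @ [ws ! i])])))"

definition n_Lie_algebra ::
  "nat \<Rightarrow> ('k::field \<Rightarrow> 'a::ab_group_add \<Rightarrow> 'a) \<Rightarrow> ('a list \<Rightarrow> 'a) \<Rightarrow> bool"
where
  "n_Lie_algebra n s b \<longleftrightarrow> vector_space s \<and> alt_multilinear s s n b \<and> filippov n b"


section \<open>Direct sum decompositions\<close>

text \<open>
  \<open>E\<close> contains \<open>\<gg>\<close> and its complement \<open>V\<close> through the linear maps \<open>iG\<close> and \<open>iV\<close>; inclusions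
  of complementary subspaces and the injections into a product are both instances.
\<close>

definition direct_sum ::
  "('k::field \<Rightarrow> 'g::ab_group_add \<Rightarrow> 'g) \<Rightarrow> ('k \<Rightarrow> 'v::ab_group_add \<Rightarrow> 'v) \<Rightarrow> ('k \<Rightarrow> 'e::ab_group_add \<Rightarrow> 'e)
    \<Rightarrow> ('g \<Rightarrow> 'e) \<Rightarrow> ('v \<Rightarrow> 'e) \<Rightarrow> bool"
where
  "direct_sum sG sV sE iG iV \<longleftrightarrow>
     Vector_Spaces.linear sG sE iG \<and> Vector_Spaces.linear sV sE iV \<and>
     bij (\<lambda>(x, u). iG x + iV u)"

definition components :: "('g \<Rightarrow> 'e::ab_group_add) \<Rightarrow> ('v \<Rightarrow> 'e) \<Rightarrow> 'e \<Rightarrow> 'g \<times> 'v" where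
  "components iG iV = inv (\<lambda>(x, u). iG x + iV u)"


section \<open>Extending brackets\<close>

text \<open>
  Brackets on \<open>E\<close> are made \<^const>\<open>undefined\<close> on lists of the wrong length, so that equality of
  the HOL functions is equality of maps on \<open>n\<close>-tuples.
\<close>

definition extending_brackets ::
  "nat \<Rightarrow> ('k::field \<Rightarrow> 'e::ab_group_add \<Rightarrow> 'e) \<Rightarrow> ('g \<Rightarrow> 'e) \<Rightarrow> ('g list \<Rightarrow> 'g) \<Rightarrow> ('e list \<Rightarrow> 'e) set"
where
  "extending_brackets n sE iG b =
     {B. B \<in> extensional {es. length es = n} \<and> n_Lie_algebra n sE B \<and>
         (\<forall>xs. length xs = n \<longrightarrow> B (map iG xs) = iG (b xs))}"

definition n_Lie_iso ::
  "nat \<Rightarrow> ('k::field \<Rightarrow> 'e::ab_group_add \<Rightarrow> 'e) \<Rightarrow> ('e list \<Rightarrow> 'e) \<Rightarrow> ('e list \<Rightarrow> 'e) \<Rightarrow> ('e \<Rightarrow> 'e) \<Rightarrow> bool"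
where
  "n_Lie_iso n sE B B' \<phi> \<longleftrightarrow>
     Vector_Spaces.linear sE sE \<phi> \<and> bij \<phi> \<and>
     (\<forall>es. length es = n \<longrightarrow> \<phi> (B es) = B' (map \<phi> es))"

definition ext_equiv ::
  "nat \<Rightarrow> ('k::field \<Rightarrow> 'e::ab_group_add \<Rightarrow> 'e) \<Rightarrow> ('g \<Rightarrow> 'e) \<Rightarrow> ('g list \<Rightarrow> 'g)
    \<Rightarrow> (('e list \<Rightarrow> 'e) \<times> ('e list \<Rightarrow> 'e)) set"
where
  "ext_equiv n sE iG b =
     {(B, B'). B \<in> extending_brackets n sE iG b \<and> B' \<in> extending_brackets n sE iG b \<and>
        (\<exists>\<phi>. n_Lie_iso n sE B B' \<phi> \<and> (\<forall>x. \<phi> (iG x) = iG x))}"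

text \<open>
  \<open>\<phi>\<close> induces the identity on \<open>E/\<gg>\<close> when it moves every vector by an element of \<open>\<gg>\<close>.
\<close>

definition ext_coequiv ::
  "nat \<Rightarrow> ('k::field \<Rightarrow> 'e::ab_group_add \<Rightarrow> 'e) \<Rightarrow> ('g \<Rightarrow> 'e) \<Rightarrow> ('g list \<Rightarrow> 'g)
    \<Rightarrow> (('e list \<Rightarrow> 'e) \<times> ('e list \<Rightarrow> 'e)) set"
where
  "ext_coequiv n sE iG b =
     {(B, B'). B \<in> extending_brackets n sE iG b \<and> B' \<in> extending_brackets n sE iG b \<and>
        (\<exists>\<phi>. n_Lie_iso n sE B B' \<phi> \<and> (\<forall>x. \<phi> (iG x) = iG x) \<and> (\<forall>e. \<phi> e - e \<in> range iG))}"

definition Extd ::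
  "nat \<Rightarrow> ('k::field \<Rightarrow> 'e::ab_group_add \<Rightarrow> 'e) \<Rightarrow> ('g \<Rightarrow> 'e) \<Rightarrow> ('g list \<Rightarrow> 'g) \<Rightarrow> ('e list \<Rightarrow> 'e) set set"
where
  "Extd n sE iG b = extending_brackets n sE iG b // ext_equiv n sE iG b"

definition Extd' ::
  "nat \<Rightarrow> ('k::field \<Rightarrow> 'e::ab_group_add \<Rightarrow> 'e) \<Rightarrow> ('g \<Rightarrow> 'e) \<Rightarrow> ('g list \<Rightarrow> 'g) \<Rightarrow> ('e list \<Rightarrow> 'e) set set"
where
  "Extd' n sE iG b = extending_brackets n sE iG b // ext_coequiv n sE iG b"


section \<open>Full extending structures\<close>

text \<open>
  A linear map \<open>\<And>\<^sup>kV \<otimes> \<And>\<^sup>n\<^sup>-\<^sup>k\<gg> \<rightarrow> W\<close> is the same as a map of \<open>k\<close> arguments in \<open>V\<close> and \<open>n - k\<close>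
  arguments in \<open>\<gg>\<close> which is alternating multilinear in each of the two groups of arguments.
  As for brackets, values outside the domain (here also \<open>k = 0\<close> and \<open>k > n\<close>) are normalised.
\<close>

definition datum_family ::
  "nat \<Rightarrow> ('k::field \<Rightarrow> 'g::ab_group_add \<Rightarrow> 'g) \<Rightarrow> ('k \<Rightarrow> 'v::ab_group_add \<Rightarrow> 'v) \<Rightarrow> ('k \<Rightarrow> 'w::ab_group_add \<Rightarrow> 'w)
    \<Rightarrow> (nat \<Rightarrow> 'v list \<Rightarrow> 'g list \<Rightarrow> 'w) \<Rightarrow> bool"
where
  "datum_family n sG sV sW \<gamma> \<longleftrightarrow>
     (\<forall>k\<in>{1..n}.
        (\<forall>xs. length xs = n - k \<longrightarrow> alt_multilinear sV sW k (\<lambda>us. \<gamma> k us xs)) \<and>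
        (\<forall>us. length us = k \<longrightarrow> alt_multilinear sG sW (n - k) (\<lambda>xs. \<gamma> k us xs))) \<and>
     (\<forall>k us xs. \<not> (k \<in> {1..n} \<and> length us = k \<and> length xs = n - k) \<longrightarrow> \<gamma> k us xs = undefined)"

type_synonym ('g, 'v) datum =
  "(nat \<Rightarrow> 'v list \<Rightarrow> 'g list \<Rightarrow> 'g) \<times> (nat \<Rightarrow> 'v list \<Rightarrow> 'g list \<Rightarrow> 'v)"

definition full_extending_datum ::
  "nat \<Rightarrow> ('k::field \<Rightarrow> 'g::ab_group_add \<Rightarrow> 'g) \<Rightarrow> ('k \<Rightarrow> 'v::ab_group_add \<Rightarrow> 'v) \<Rightarrow> ('g, 'v) datum \<Rightarrow> bool"
where
  "full_extending_datum n sG sV \<Gamma> \<longleftrightarrow>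
     datum_family n sG sV sG (fst \<Gamma>) \<and> datum_family n sG sV sV (snd \<Gamma>)"

text \<open>
  \<open>I\<close> is the set of 0-based positions of the arguments taken from \<open>V\<close>; the exponent is written
  with 1-based positions. The argument \<open>z\<close> plays the role of the component of degree \<open>k = 0\<close>.
\<close>

definition shuffle_sum ::
  "('k::field \<Rightarrow> 'w::ab_group_add \<Rightarrow> 'w) \<Rightarrow> nat \<Rightarrow> ('g list \<Rightarrow> 'w) \<Rightarrow> (nat \<Rightarrow> 'v list \<Rightarrow> 'g list \<Rightarrow> 'w)
    \<Rightarrow> 'g list \<Rightarrow> 'v list \<Rightarrow> 'w"
where
  "shuffle_sum s n z \<gamma> xs us =
     (\<Sum>k\<le>n. \<Sum>I | I \<subseteq> {..<n} \<and> card I = k.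
        s ((-1) ^ ((\<Sum>i\<in>I. i + 1) - k * (k + 1) div 2))
          (if k = 0 then z xs else \<gamma> k (nths us I) (nths xs ({..<n} - I))))"

definition Gop ::
  "('k::field \<Rightarrow> 'g::ab_group_add \<Rightarrow> 'g) \<Rightarrow> nat \<Rightarrow> ('g list \<Rightarrow> 'g) \<Rightarrow> ('g, 'v) datum
    \<Rightarrow> 'g list \<Rightarrow> 'v list \<Rightarrow> 'g"
where
  "Gop sG n b \<Gamma> = shuffle_sum sG n b (fst \<Gamma>)"

definition Hop ::
  "('k::field \<Rightarrow> 'v::ab_group_add \<Rightarrow> 'v) \<Rightarrow> nat \<Rightarrow> ('g, 'v) datum \<Rightarrow> 'g list \<Rightarrow> 'v list \<Rightarrow> 'v"
where
  "Hop sV n \<Gamma> = shuffle_sum sV n (\<lambda>_. 0) (snd \<Gamma>)"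

definition full_bracket ::
  "nat \<Rightarrow> ('k::field \<Rightarrow> 'g::ab_group_add \<Rightarrow> 'g) \<Rightarrow> ('k \<Rightarrow> 'v::ab_group_add \<Rightarrow> 'v)
    \<Rightarrow> ('g list \<Rightarrow> 'g) \<Rightarrow> ('g, 'v) datum \<Rightarrow> ('g \<times> 'v) list \<Rightarrow> 'g \<times> 'v"
where
  "full_bracket n sG sV b \<Gamma> ps =
     (Gop sG n b \<Gamma> (map fst ps) (map snd ps), Hop sV n \<Gamma> (map fst ps) (map snd ps))"

text \<open>The same bracket on \<open>E\<close>, via the identification of \<open>E\<close> with \<open>\<gg> \<oplus> V\<close>.\<close>

definition full_bracket_on ::
  "('g \<Rightarrow> 'e::ab_group_add) \<Rightarrow> ('v \<Rightarrow> 'e) \<Rightarrow> nat \<Rightarrow> ('k::field \<Rightarrow> 'g::ab_group_add \<Rightarrow> 'g)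
    \<Rightarrow> ('k \<Rightarrow> 'v::ab_group_add \<Rightarrow> 'v) \<Rightarrow> ('g list \<Rightarrow> 'g) \<Rightarrow> ('g, 'v) datum \<Rightarrow> 'e list \<Rightarrow> 'e"
where
  "full_bracket_on iG iV n sG sV b \<Gamma> =
     (\<lambda>es\<in>{es. length es = n}.
        case full_bracket n sG sV b \<Gamma> (map (components iG iV) es) of (x, u) \<Rightarrow> iG x + iV u)"

definition full_extending_structures ::
  "nat \<Rightarrow> ('k::field \<Rightarrow> 'g::ab_group_add \<Rightarrow> 'g) \<Rightarrow> ('k \<Rightarrow> 'v::ab_group_add \<Rightarrow> 'v)
    \<Rightarrow> ('g list \<Rightarrow> 'g) \<Rightarrow> ('g, 'v) datum set"
where
  "full_extending_structures n sG sV b =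
     {\<Gamma>. full_extending_datum n sG sV \<Gamma> \<and> filippov n (full_bracket n sG sV b \<Gamma>)}"

definition intertwines ::
  "nat \<Rightarrow> ('k::field \<Rightarrow> 'g::ab_group_add \<Rightarrow> 'g) \<Rightarrow> ('k \<Rightarrow> 'v::ab_group_add \<Rightarrow> 'v) \<Rightarrow> ('g list \<Rightarrow> 'g)
    \<Rightarrow> ('v \<Rightarrow> 'g) \<Rightarrow> ('v \<Rightarrow> 'v) \<Rightarrow> ('g, 'v) datum \<Rightarrow> ('g, 'v) datum \<Rightarrow> bool"
where
  "intertwines n sG sV b r s \<Gamma> \<Lambda> \<longleftrightarrow>
     (\<forall>xs us. length xs = n \<longrightarrow> length us = n \<longrightarrow>
        Gop sG n b \<Gamma> xs us + r (Hop sV n \<Gamma> xs us)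
          = Gop sG n b \<Lambda> (map2 (\<lambda>x u. x + r u) xs us) (map s us) \<and>
        s (Hop sV n \<Gamma> xs us) = Hop sV n \<Lambda> (map2 (\<lambda>x u. x + r u) xs us) (map s us))"

definition struct_equiv ::
  "nat \<Rightarrow> ('k::field \<Rightarrow> 'g::ab_group_add \<Rightarrow> 'g) \<Rightarrow> ('k \<Rightarrow> 'v::ab_group_add \<Rightarrow> 'v)
    \<Rightarrow> ('g list \<Rightarrow> 'g) \<Rightarrow> (('g, 'v) datum \<times> ('g, 'v) datum) set"
where
  "struct_equiv n sG sV b =
     {(\<Gamma>, \<Lambda>). \<Gamma> \<in> full_extending_structures n sG sV b \<and>
        \<Lambda> \<in> full_extending_structures n sG sV b \<and>
        (\<exists>r s. Vector_Spaces.linear sV sG r \<and> Vector_Spaces.linear sV sV s \<and> bij s \<and>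
               intertwines n sG sV b r s \<Gamma> \<Lambda>)}"

definition struct_coequiv ::
  "nat \<Rightarrow> ('k::field \<Rightarrow> 'g::ab_group_add \<Rightarrow> 'g) \<Rightarrow> ('k \<Rightarrow> 'v::ab_group_add \<Rightarrow> 'v)
    \<Rightarrow> ('g list \<Rightarrow> 'g) \<Rightarrow> (('g, 'v) datum \<times> ('g, 'v) datum) set"
where
  "struct_coequiv n sG sV b =
     {(\<Gamma>, \<Lambda>). \<Gamma> \<in> full_extending_structures n sG sV b \<and>
        \<Lambda> \<in> full_extending_structures n sG sV b \<and>
        (\<exists>r. Vector_Spaces.linear sV sG r \<and> intertwines n sG sV b r id \<Gamma> \<Lambda>)}"

end

theory Submission
  imports Defs
begin

text \<open>
  Send a full extending structure \<open>\<Gamma>\<close> to its bracket on \<open>E\<close>. Both bijections follow from two facts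
  about this map: it is onto the extending brackets, and the two relations on structures are the
  pullbacks along it of the two relations on brackets. A surjection always induces a bijection
  between the quotients by a pulled back equivalence relation and by the original one
  (\<open>quotient_bij_of_pullback\<close>).

  The bracket of a datum is alternating multilinear (\<open>alt_multilinear_signed_sum\<close>). For alternation
  it suffices to repeat an argument in adjacent places \<open>p\<close>, \<open>p + 1\<close>
  (\<open>alt_multilinear_iff_adjacent\<close>). A summand indexed by \<open>I\<close> which contains both or neither of
  these places then vanishes because a component of the datum is alternating, and the other
  summands cancel in pairs: exchanging \<open>p\<close> and \<open>p + 1\<close> in \<open>I\<close> changes the exponent of \<open>-1\<close> by one
  and nothing else.

  On a list in which vectors of \<open>V\<close> precede vectors of \<open>\<gg>\<close> only one summand survives, with
  sign \<open>+1\<close> (\<open>signed_sum_sorted\<close>). An alternating map on \<open>E\<close> is determined by its values on such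
  lists (\<open>alt_multilinear_eq_if_eq_on_sorted\<close>). Hence a given extending bracket is the bracket of
  the datum obtained by restricting it to sorted lists and projecting to \<open>\<gg>\<close> and \<open>V\<close>
  (\<open>bracket_of_surj\<close>): the two agree on sorted lists, hence everywhere, which replaces the
  expansion of the bracket with its shuffle signs.

  Finally, the linear automorphisms of \<open>E\<close> fixing \<open>\<gg>\<close> are the maps \<open>x + u \<mapsto> x + r(u) + s(u)\<close>
  with \<open>r\<close> linear and \<open>s\<close> invertible, and \<open>s\<close> is the induced map on \<open>E/\<gg> = V\<close>. The two components
  of the condition that such a map is a homomorphism are exactly the equations relating
  \<open>\<Gamma>\<close> and \<open>\<Lambda>\<close> (\<open>intertwines_iff_shear\<close>).
\<close>

section \<open>Alternating multilinear maps\<close>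

lemma alt_multilinear_slot:
  assumes "alt_multilinear s t m f" "length pre + length post + 1 = m"
  shows "Vector_Spaces.linear s t (\<lambda>y. f (pre @ y # post))"
proof -
  have "Vector_Spaces.linear s t (\<lambda>y. f ((pre @ 0 # post)[length pre := y]))"
    using assms(1)[unfolded alt_multilinear_def, THEN conjunct1, rule_format,
        of "pre @ 0 # post" "length pre"] assms(2) by simp
  then show ?thesis by (simp add: list_update_length)
qed

lemma alt_multilinear_add:
  assumes "alt_multilinear s t m f" "length pre + length post + 1 = m"
  shows "f (pre @ (x + y) # post) = f (pre @ x # post) + f (pre @ y # post)"
  using alt_multilinear_slot[OF assms] by (simp add: Vector_Spaces.linear_iff)

lemma alt_multilinear_adjacent:
  assumes "alt_multilinear s t m f" "length pre + length post + 2 = m"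
  shows "f (pre @ a # a # post) = 0"
proof -
  have "(pre @ a # a # post) ! length pre = (pre @ a # a # post) ! Suc (length pre)"
    by (simp add: nth_append)
  with assms show ?thesis unfolding alt_multilinear_def
    by (metis (no_types, lifting) add_2_eq_Suc' add_Suc_right length_Cons length_append
        less_add_same_cancel1 lessI not_add_less1 not_less_eq zero_less_Suc)
qed

lemma alt_multilinear_zero:
  assumes "alt_multilinear s t m f" "length xs = m" "0 \<in> set xs"
  shows "f xs = 0"
proof -
  obtain pre post where xs: "xs = pre @ 0 # post" using assms(3) by (meson split_list)
  have "f (pre @ (0 + 0) # post) = f (pre @ 0 # post) + f (pre @ 0 # post)"
    using assms xs by (intro alt_multilinear_add) auto
  then show ?thesis by (simp add: xs)
qed

text \<open>
  The hypotheses are additivity and vanishing on adjacent equal arguments, rather than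
  \<^const>\<open>alt_multilinear\<close>, because the lemma serves to derive the latter from them.
\<close>

lemma swap_adjacent:
  fixes f :: "'a::ab_group_add list \<Rightarrow> 'b::ab_group_add"
  assumes add: "\<And>pre post x y. length pre + length post + 1 = m \<Longrightarrow>
      f (pre @ (x + y) # post) = f (pre @ x # post) + f (pre @ y # post)"
    and alt: "\<And>pre post a. length pre + length post + 2 = m \<Longrightarrow> f (pre @ a # a # post) = 0"
    and len: "length pre + length post + 2 = m"
  shows "f (pre @ x # y # post) = - f (pre @ y # x # post)"
proof -
  have "0 = f (pre @ (x + y) # (x + y) # post)" using alt len by simp
  also have "\<dots> = f (pre @ x # (x + y) # post) + f (pre @ y # (x + y) # post)"
    using len by (intro add) auto
  also have "\<dots> = f (pre @ x # y # post) + f (pre @ y # x # post)"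
    using add[of "pre @ [x]" post x y] add[of "pre @ [y]" post x y] alt len by simp
  finally show ?thesis by (simp add: eq_neg_iff_add_eq_0)
qed

lemma move_past:
  fixes f :: "'a::ab_group_add list \<Rightarrow> 'b::ab_group_add"
  assumes swap: "\<And>pre post x y. length pre + length post + 2 = m \<Longrightarrow>
      f (pre @ x # y # post) = - f (pre @ y # x # post)"
    and len: "length pre + length mid + length post + 1 = m"
  shows "f (pre @ a # mid @ post)
       = (if even (length mid) then f (pre @ mid @ a # post) else - f (pre @ mid @ a # post))"
  using len
proof (induction mid arbitrary: pre)
  case (Cons c mid)
  have "f (pre @ a # c # mid @ post) = - f ((pre @ [c]) @ a # mid @ post)"
    using swap[of pre "mid @ post" a c] Cons.prems by simp
  also have "\<dots> = (if even (length (c # mid)) then f (pre @ (c # mid) @ a # post)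
      else - f (pre @ (c # mid) @ a # post))"
    using Cons.prems by (subst Cons.IH) auto
  finally show ?case by simp
qed simp

text \<open>
  Two equal arguments in distant places can be made adjacent by moving one past the arguments in
  between, which only changes the sign.
\<close>

lemma alt_multilinear_iff_adjacent:
  "alt_multilinear s t m f \<longleftrightarrow>
     (\<forall>pre post. length pre + length post + 1 = m \<longrightarrow>
        Vector_Spaces.linear s t (\<lambda>y. f (pre @ y # post))) \<and>
     (\<forall>pre a post. length pre + length post + 2 = m \<longrightarrow> f (pre @ a # a # post) = 0)"
  (is "_ \<longleftrightarrow> ?lin \<and> ?adj")
proof
  assume "alt_multilinear s t m f"
  then show "?lin \<and> ?adj"
    using alt_multilinear_slot alt_multilinear_adjacent by blast
next
  assume R: "?lin \<and> ?adj"
  then have add: "f (pre @ (x + y) # post) = f (pre @ x # post) + f (pre @ y # post)"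
    if "length pre + length post + 1 = m" for pre post x y
    using that by (simp add: Vector_Spaces.linear_iff)
  from R have adj: "f (pre @ a # a # post) = 0" if "length pre + length post + 2 = m" for pre a post
    using that by blast
  note swap = swap_adjacent[of m f, OF add adj]
  show "alt_multilinear s t m f"
    unfolding alt_multilinear_def
  proof (intro conjI allI impI)
    fix xs :: "'b list" and i
    assume "length xs = m" "i < m"
    moreover from this have "xs[i := y] = take i xs @ y # drop (Suc i) xs" for y
      by (simp add: upd_conv_take_nth_drop)
    ultimately show "Vector_Spaces.linear s t (\<lambda>y. f (xs[i := y]))"
      using R by simp
  next
    fix xs :: "'b list" and i j
    assume len: "length xs = m" and ij: "i < j" "j < m" and eq: "xs ! i = xs ! j"
    define pre mid post where "pre = take i xs" and "mid = take (j - Suc i) (drop (Suc i) xs)"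
      and "post = drop (Suc j) xs"
    have "drop (Suc i) xs = mid @ drop (j - Suc i) (drop (Suc i) xs)"
      unfolding mid_def by (rule append_take_drop_id[symmetric])
    also have "drop (j - Suc i) (drop (Suc i) xs) = xs ! j # post"
      using ij len by (simp add: post_def Cons_nth_drop_Suc)
    finally have xs: "xs = pre @ xs ! j # mid @ xs ! j # post"
      using ij len eq by (metis pre_def id_take_nth_drop less_trans)
    have l: "length pre + length mid + length (xs ! j # post) + 1 = m"
      using arg_cong[OF xs, of length] len by simp
    have "f ((pre @ mid) @ xs ! j # xs ! j # post) = 0"
      using l by (intro adj) auto
    then have "f (pre @ xs ! j # mid @ xs ! j # post) = 0"
      using move_past[of m f pre mid "xs ! j # post" "xs ! j", OF swap l] by simp
    then show "f xs = 0" using xs by simp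
  qed
qed

lemma alt_multilinear_swap:
  assumes "alt_multilinear s t m f" "length pre + length post + 2 = m"
  shows "f (pre @ x # y # post) = - f (pre @ y # x # post)"
  using assms alt_multilinear_add[OF assms(1)] alt_multilinear_adjacent[OF assms(1)]
  by (intro swap_adjacent[of m f]) auto

text \<open>
  Split the arguments, from left to right, into their components. A component in \<open>\<gg>\<close> may stay at
  the end of the sorted initial segment; a component in \<open>V\<close> has to move past the vectors of \<open>\<gg>\<close>
  already there, which changes the values of both maps by the same sign.
\<close>

lemma alt_multilinear_eq_if_eq_on_sorted:
  assumes F: "alt_multilinear sE sW n F" and F': "alt_multilinear sE sW n F'"
    and span: "\<And>e. \<exists>x u. e = iG x + iV u"
    and sorted: "\<And>us xs. length us + length xs = n \<Longrightarrow>
        F (map iV us @ map iG xs) = F' (map iV us @ map iG xs)"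
    and len: "length es = n"
  shows "F es = F' es"
proof -
  have "F (map iV us @ map iG xs @ es) = F' (map iV us @ map iG xs @ es)"
    if "length us + length xs + length es = n" for us xs es
    using that
  proof (induction es arbitrary: us xs)
    case Nil
    then show ?case by (simp add: sorted)
  next
    case (Cons e es)
    obtain x u where e: "e = iG x + iV u" using span by blast
    have lin: "H (map iV us @ map iG xs @ e # es)
        = H (map iV us @ map iG (xs @ [x]) @ es) + H (map iV us @ map iG xs @ iV u # es)"
      if "alt_multilinear sE sW n H" for H
      using alt_multilinear_add[OF that, of "map iV us @ map iG xs" es "iG x" "iV u"] Cons.prems
      by (simp add: e)
    have G: "F (map iV us @ map iG (xs @ [x]) @ es) = F' (map iV us @ map iG (xs @ [x]) @ es)"
      using Cons.prems by (intro Cons.IH) simp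
    have V': "F (map iV (us @ [u]) @ map iG xs @ es) = F' (map iV (us @ [u]) @ map iG xs @ es)"
      using Cons.prems by (intro Cons.IH) simp
    have mv: "H (map iV (us @ [u]) @ map iG xs @ es)
        = (if even (length xs) then H (map iV us @ map iG xs @ iV u # es)
           else - H (map iV us @ map iG xs @ iV u # es))"
      if "alt_multilinear sE sW n H" for H
      using move_past[of n H "map iV us" "map iG xs" es "iV u", OF alt_multilinear_swap[OF that]]
        Cons.prems by simp
    have "F (map iV us @ map iG xs @ iV u # es) = F' (map iV us @ map iG xs @ iV u # es)"
      using V' mv[OF F] mv[OF F'] by (simp split: if_splits)
    with G show ?case using lin[OF F] lin[OF F'] by simp
  qed
  from this[of "[]" "[]" es] len show ?thesis by simp
qed

section \<open>Shuffle sums\<close>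

definition shuffle_exponent :: "nat set \<Rightarrow> nat" where
  "shuffle_exponent I = (\<Sum>i\<in>I. i + 1) - card I * (card I + 1) div 2"

text \<open>
  This makes the truncated subtraction in the exponent an honest one, so that changing the sum of the
  positions by one changes the parity of the exponent.
\<close>

lemma triangle_le_sum_positions: "card I * (card I + 1) div 2 \<le> (\<Sum>i\<in>I. i + 1)"
proof -
  have "card I * (card I + 1) div 2 = \<Sum>{0..<card I} + card I"
    by (cases "card I") (auto simp: Sum_Ico_nat algebra_simps)
  moreover have "(\<Sum>i\<in>I. i + 1) = \<Sum>I + card I" by (simp only: sum.distrib) simp
  ultimately show ?thesis using card_sum_le_nat_sum[of I] by linarith
qed

lemma shuffle_exponent_shift:
  assumes "finite I" "p \<in> I" "Suc p \<notin> I"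
  shows "shuffle_exponent (insert (Suc p) (I - {p})) = Suc (shuffle_exponent I)"
proof -
  have c: "card (insert (Suc p) (I - {p})) = card I"
    using assms by (metis DiffD1 card_insert_disjoint card_Suc_Diff1 finite_Diff)
  have "(\<Sum>i\<in>insert (Suc p) (I - {p}). i + 1) = Suc (\<Sum>i\<in>I. i + 1)"
    using assms by (simp add: sum.remove[of I p])
  then show ?thesis
    using triangle_le_sum_positions[of I] unfolding shuffle_exponent_def c by simp
qed

lemma shuffle_exponent_initial: "shuffle_exponent {..<k} = 0"
proof -
  have "(\<Sum>i<k. i + 1) = k * (k + 1) div 2"
    by (induction k) auto
  then show ?thesis by (simp add: shuffle_exponent_def)
qed


text \<open>
  The shuffle sum as a single sum over all sets of positions, with the component of degree \<open>0\<close>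
  on the same footing as the others.
\<close>

definition signed_sum ::
  "('k::field \<Rightarrow> 'w::ab_group_add \<Rightarrow> 'w) \<Rightarrow> nat \<Rightarrow> (nat \<Rightarrow> 'v list \<Rightarrow> 'g list \<Rightarrow> 'w)
    \<Rightarrow> 'g list \<Rightarrow> 'v list \<Rightarrow> 'w"
where
  "signed_sum s n \<delta> xs us =
     (\<Sum>I\<in>Pow {..<n}. s ((-1) ^ shuffle_exponent I)
        (\<delta> (card I) (nths us I) (nths xs ({..<n} - I))))"

text \<open>
  In contrast to \<^const>\<open>datum_family\<close>, the degree \<open>0\<close> is included: the bracket of \<open>\<gg>\<close> becomes one more
  component.
\<close>

definition bialternating_family ::
  "nat \<Rightarrow> ('k::field \<Rightarrow> 'g::ab_group_add \<Rightarrow> 'g) \<Rightarrow> ('k \<Rightarrow> 'v::ab_group_add \<Rightarrow> 'v) \<Rightarrow> ('k \<Rightarrow> 'w::ab_group_add \<Rightarrow> 'w)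
    \<Rightarrow> (nat \<Rightarrow> 'v list \<Rightarrow> 'g list \<Rightarrow> 'w) \<Rightarrow> bool"
where
  "bialternating_family n sG sV sW \<delta> \<longleftrightarrow>
     (\<forall>k\<le>n. (\<forall>xs. length xs = n - k \<longrightarrow> alt_multilinear sV sW k (\<lambda>us. \<delta> k us xs)) \<and>
            (\<forall>us. length us = k \<longrightarrow> alt_multilinear sG sW (n - k) (\<lambda>xs. \<delta> k us xs)))"

definition with_degree_zero ::
  "('g list \<Rightarrow> 'w) \<Rightarrow> (nat \<Rightarrow> 'v list \<Rightarrow> 'g list \<Rightarrow> 'w) \<Rightarrow> nat \<Rightarrow> 'v list \<Rightarrow> 'g list \<Rightarrow> 'w" where
  "with_degree_zero z \<gamma> k us xs = (if k = 0 then z xs else \<gamma> k us xs)"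

lemma bialternating_with_degree_zero:
  assumes "datum_family n sG sV sW \<gamma>" "alt_multilinear sG sW n z"
  shows "bialternating_family n sG sV sW (with_degree_zero z \<gamma>)"
  unfolding bialternating_family_def
proof (intro allI impI)
  fix k assume "k \<le> n"
  show "(\<forall>xs. length xs = n - k \<longrightarrow> alt_multilinear sV sW k (\<lambda>us. with_degree_zero z \<gamma> k us xs)) \<and>
        (\<forall>us. length us = k \<longrightarrow> alt_multilinear sG sW (n - k) (\<lambda>xs. with_degree_zero z \<gamma> k us xs))"
  proof (cases "k = 0")
    case True
    then show ?thesis
      using assms(2) by (simp add: with_degree_zero_def alt_multilinear_def)
  next
    case False
    then show ?thesis
      using assms(1) \<open>k \<le> n\<close> by (simp add: with_degree_zero_def datum_family_def)
  qed
qed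

lemma shuffle_sum_eq_signed_sum:
  assumes "length xs = n"
  shows "shuffle_sum s n z \<gamma> xs us = signed_sum s n (with_degree_zero z \<gamma>) xs us"
proof -
  have "signed_sum s n (with_degree_zero z \<gamma>) xs us
      = (\<Sum>k\<le>n. \<Sum>I | I \<in> Pow {..<n} \<and> card I = k. s ((-1) ^ shuffle_exponent I)
        (with_degree_zero z \<gamma> (card I) (nths us I) (nths xs ({..<n} - I))))"
    unfolding signed_sum_def
    by (rule sum.group[symmetric]) (use card_mono[of "{..<n}"] in auto)
  also have "\<dots> = shuffle_sum s n z \<gamma> xs us"
    unfolding shuffle_sum_def
  proof (rule sum.cong[OF refl], rule sum.cong)
    fix k I assume "I \<in> {I. I \<subseteq> {..<n} \<and> card I = k}"
    then have I: "I \<subseteq> {..<n}" "card I = k" by auto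
    then have "k = 0 \<Longrightarrow> I = {}" using finite_subset by fastforce
    then show "s ((-1) ^ shuffle_exponent I)
        (with_degree_zero z \<gamma> (card I) (nths us I) (nths xs ({..<n} - I)))
      = s ((-1) ^ ((\<Sum>i\<in>I. i + 1) - k * (k + 1) div 2))
        (if k = 0 then z xs else \<gamma> k (nths us I) (nths xs ({..<n} - I)))"
      using I assms by (auto simp: with_degree_zero_def shuffle_exponent_def)
  qed auto
  finally show ?thesis by simp
qed

lemma length_nths_subset: "I \<subseteq> {..<length xs} \<Longrightarrow> length (nths xs I) = card I"
  unfolding length_nths by (rule arg_cong[of _ _ card]) auto

lemma nths_cong: "(\<And>i. i < length xs \<Longrightarrow> i \<in> A \<longleftrightarrow> i \<in> B) \<Longrightarrow> nths xs A = nths xs B"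
  unfolding nths_def
  by (intro arg_cong[of _ _ "map fst"] filter_cong refl) (metis atLeastLessThan_iff atLeastLessThan_upt prod.collapse set_zip_rightD)

lemma nths_append_Cons:
  "nths (pre @ y # post) A =
     nths pre A @ (if length pre \<in> A then [y] else []) @ nths post {j. Suc (j + length pre) \<in> A}"
  by (simp add: nths_append nths_Cons)

text \<open>
  A set \<open>I\<close> other than the initial segment of length \<open>k\<close> selects one of the zeros, either in the
  list of vectors of \<open>V\<close> or in the list of vectors of \<open>\<gg>\<close>.
\<close>

lemma signed_sum_sorted:
  assumes vs: "vector_space s" and \<delta>: "bialternating_family n sG sV s \<delta>"
    and len: "length us = k" "length xs = n - k" "k \<le> n"
  shows "signed_sum s n \<delta> (replicate k 0 @ xs) (us @ replicate (n - k) 0) = \<delta> k us xs"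
proof -
  interpret vector_space s by (rule vs)
  let ?xs = "replicate k 0 @ xs" and ?us = "us @ replicate (n - k) 0"
  let ?t = "\<lambda>I. s ((-1) ^ shuffle_exponent I)
    (\<delta> (card I) (nths ?us I) (nths ?xs ({..<n} - I)))"
  have zero: "?t I = 0" if I: "I \<in> Pow {..<n} - {{..<k}}" for I
  proof -
    have card: "card I \<le> n" "card ({..<n} - I) = n - card I"
      using I card_mono[of "{..<n}" I] by (auto simp: card_Diff_subset finite_subset)
    have lens: "length (nths ?us I) = card I" "length (nths ?xs ({..<n} - I)) = n - card I"
      using I len card by (subst length_nths_subset; auto)+
    consider i where "i \<in> I" "k \<le> i" | i where "i < k" "i \<notin> I"
      using I by fastforce
    then have "\<delta> (card I) (nths ?us I) (nths ?xs ({..<n} - I)) = 0"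
    proof cases
      case 1
      have "i < n" using I 1 by auto
      then have "0 \<in> set (nths ?us I)"
        unfolding set_nths using 1 len by (auto simp: nth_append intro!: exI[of _ i])
      then show ?thesis
        using \<delta> card lens unfolding bialternating_family_def
        by (intro alt_multilinear_zero[of sV s "card I" "\<lambda>us. \<delta> (card I) us _"]) auto
    next
      case 2
      then have "0 \<in> set (nths ?xs ({..<n} - I))"
        unfolding set_nths using len by (auto simp: nth_append intro!: exI[of _ i])
      then show ?thesis
        using \<delta> card lens unfolding bialternating_family_def
        by (intro alt_multilinear_zero[of sG s "n - card I" "\<delta> (card I) _"]) auto
    qed
    then show ?thesis by simp
  qed
  have "signed_sum s n \<delta> ?xs ?us = ?t {..<k} + (\<Sum>I\<in>Pow {..<n} - {{..<k}}. ?t I)"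
    unfolding signed_sum_def using len by (intro sum.remove) auto
  also have "\<dots> = ?t {..<k}" using zero by simp
  also have "nths ?xs ({..<n} - {..<k}) = xs"
  proof -
    have "nths (replicate k 0) ({..<n} - {..<k}) = []"
      by (simp flip: length_0_conv add: length_nths)
    moreover have "nths xs {j. j + k \<in> {..<n} - {..<k}} = xs"
      using len by (intro nths_all) auto
    ultimately show ?thesis by (simp add: nths_append)
  qed
  also have "nths ?us {..<k} = us" using len by simp
  finally show ?thesis by (simp add: shuffle_exponent_initial)
qed

lemma linear_after_linear:
  assumes "Vector_Spaces.linear s1 s2 f" "Vector_Spaces.linear s2 s3 g"
  shows "Vector_Spaces.linear s1 s3 (\<lambda>x. g (f x))"
  using assms by (simp add: Vector_Spaces.linear_iff)

lemma linear_scaled_sum: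
  assumes "vector_space s1" "vector_space s2" "\<And>i. i \<in> I \<Longrightarrow> Vector_Spaces.linear s1 s2 (f i)"
  shows "Vector_Spaces.linear s1 s2 (\<lambda>x. \<Sum>i\<in>I. s2 (c i) (f i x))"
proof -
  interpret vector_space s2 by (rule assms(2))
  show ?thesis
    using assms by (auto simp: Vector_Spaces.linear_iff scale_right_distrib sum.distrib scale_sum_right
        scale_left_commute intro!: sum.cong)
qed

text \<open>
  For arguments repeated at \<open>p\<close> and \<open>p + 1\<close>, the sets \<open>S\<close> of index sets containing only \<open>p\<close> and \<open>T\<close> of
  those containing only \<open>p + 1\<close> are in bijection, and corresponding summands differ by a sign: as the
  arguments agree, both select the same sublists.
\<close>

lemma alt_multilinear_signed_sum:
  fixes pG :: "'e::ab_group_add \<Rightarrow> 'g::ab_group_add" and pV :: "'e \<Rightarrow> 'v::ab_group_add"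
    and sW :: "'k::field \<Rightarrow> 'w::ab_group_add \<Rightarrow> 'w"
  assumes \<delta>: "bialternating_family n sG sV sW \<delta>" and vs: "vector_space sW"
    and G: "Vector_Spaces.linear sE sG pG" and V: "Vector_Spaces.linear sE sV pV"
  shows "alt_multilinear sE sW n (\<lambda>es. signed_sum sW n \<delta> (map pG es) (map pV es))"
  unfolding alt_multilinear_iff_adjacent
proof (intro conjI allI impI)
  interpret vector_space sW by (rule vs)
  have \<delta>V: "alt_multilinear sV sW (card I) (\<lambda>us. \<delta> (card I) us (nths xs ({..<n} - I)))"
    and \<delta>G: "alt_multilinear sG sW (card ({..<n} - I)) (\<lambda>xs. \<delta> (card I) (nths us I) xs)"
    if "I \<subseteq> {..<n}" "length xs = n" "length us = n" for I us xs
  proof -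
    have card: "card I \<le> n" "card ({..<n} - I) = n - card I"
      using that card_mono[of "{..<n}" I] by (auto simp: card_Diff_subset finite_subset)
    moreover have "length (nths us I) = card I" "length (nths xs ({..<n} - I)) = n - card I"
      using that card by (subst length_nths_subset; auto)+
    ultimately show "alt_multilinear sV sW (card I) (\<lambda>us. \<delta> (card I) us (nths xs ({..<n} - I)))"
      "alt_multilinear sG sW (card ({..<n} - I)) (\<lambda>xs. \<delta> (card I) (nths us I) xs)"
      using \<delta> unfolding bialternating_family_def by auto
  qed
  {
    fix pre post :: "'e list"
    assume len: "length pre + length post + 1 = n"
    show "Vector_Spaces.linear sE sW (\<lambda>y. signed_sum sW n \<delta> (map pG (pre @ y # post)) (map pV (pre @ y # post)))"
      unfolding signed_sum_def
    proof (rule linear_scaled_sum)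
      show "vector_space sE" using G by (simp add: Vector_Spaces.linear_iff)
    next
      fix I assume "I \<in> Pow {..<n}"
      then have I: "I \<subseteq> {..<n}" by simp
      let ?p = "length pre"
      let ?t = "\<lambda>y. \<delta> (card I) (nths (map pV (pre @ y # post)) I)
        (nths (map pG (pre @ y # post)) ({..<n} - I))"
      show "Vector_Spaces.linear sE sW ?t"
      proof (cases "?p \<in> I")
        case True
        define A B X where "A = nths (map pV pre) I" and "B = nths (map pV post) {j. Suc (j + ?p) \<in> I}"
          and "X = nths (map pG (pre @ 0 # post)) ({..<n} - I)"
        have t: "?t = (\<lambda>y. \<delta> (card I) (A @ pV y # B) X)"
          using True by (simp add: A_def B_def X_def nths_append_Cons)
        have "length (nths (map pV (pre @ 0 # post)) I) = card I"
          using I len by (intro length_nths_subset) auto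
        then have "length A + length B + 1 = card I"
          using True by (simp add: A_def B_def nths_append_Cons)
        then have "Vector_Spaces.linear sV sW (\<lambda>u. \<delta> (card I) (A @ u # B) X)"
          using \<delta>V[OF I, of "map pG (pre @ 0 # post)" "map pV (pre @ 0 # post)"] len
          by (intro alt_multilinear_slot[of _ _ _ "\<lambda>us. \<delta> (card I) us X"]) (auto simp: X_def)
        from linear_after_linear[OF V this] show ?thesis unfolding t .
      next
        case False
        let ?J = "{..<n} - I"
        define A B X where "A = nths (map pG pre) ?J" and "B = nths (map pG post) {j. Suc (j + ?p) \<in> ?J}"
          and "X = nths (map pV (pre @ 0 # post)) I"
        have p: "?p \<in> ?J" using False len by auto
        have t: "?t = (\<lambda>y. \<delta> (card I) X (A @ pG y # B))"
          using False p by (simp add: A_def B_def X_def nths_append_Cons)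
        have "length (nths (map pG (pre @ 0 # post)) ?J) = card ?J"
          using I len by (intro length_nths_subset) auto
        then have "length A + length B + 1 = card ?J"
          using p by (simp add: A_def B_def nths_append_Cons)
        then have "Vector_Spaces.linear sG sW (\<lambda>x. \<delta> (card I) X (A @ x # B))"
          using \<delta>G[OF I, of "map pG (pre @ 0 # post)" "map pV (pre @ 0 # post)"] len
          by (intro alt_multilinear_slot[of _ _ _ "\<lambda>xs. \<delta> (card I) X xs"]) (auto simp: X_def)
        from linear_after_linear[OF G this] show ?thesis unfolding t .
      qed
    qed (rule vs)
  next
    fix pre post :: "'e list" and a
    assume len: "length pre + length post + 2 = n"
    let ?p = "length pre"
    let ?us = "map pV (pre @ a # a # post)" and ?xs = "map pG (pre @ a # a # post)"
    let ?t = "\<lambda>I. \<delta> (card I) (nths ?us I) (nths ?xs ({..<n} - I))"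
    let ?st = "\<lambda>I. sW ((-1) ^ shuffle_exponent I) (?t I)"
    define S where "S = {I \<in> Pow {..<n}. ?p \<in> I \<and> Suc ?p \<notin> I}"
    define T where "T = {I \<in> Pow {..<n}. ?p \<notin> I \<and> Suc ?p \<in> I}"
    have decV: "nths ?us A = nths (map pV pre) A @ (if ?p \<in> A then [pV a] else [])
        @ (if Suc ?p \<in> A then [pV a] else []) @ nths (map pV post) {j. Suc (Suc (j + ?p)) \<in> A}"
      and decG: "nths ?xs A = nths (map pG pre) A @ (if ?p \<in> A then [pG a] else [])
        @ (if Suc ?p \<in> A then [pG a] else []) @ nths (map pG post) {j. Suc (Suc (j + ?p)) \<in> A}"
      for A
      by (simp_all add: nths_append nths_Cons)
    have zero: "?st I = 0" if inert: "I \<in> Pow {..<n} - (S \<union> T)" for I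
    proof -
      have I: "I \<subseteq> {..<n}" using that by auto
      have lens: "length (nths ?us I) = card I" "length (nths ?xs ({..<n} - I)) = card ({..<n} - I)"
        using I len by (auto intro!: length_nths_subset)
      consider "?p \<in> I" "Suc ?p \<in> I" | "?p \<notin> I" "Suc ?p \<notin> I"
        using inert by (auto simp: S_def T_def)
      then have "?t I = 0"
      proof cases
        case 1
        then show ?thesis
          using alt_multilinear_adjacent[OF \<delta>V[OF I, of ?xs ?us], of "nths (map pV pre) I"
              "nths (map pV post) {j. Suc (Suc (j + ?p)) \<in> I}" "pV a"] lens(1) len
          unfolding decV by simp
      next
        case 2
        then show ?thesis
          using alt_multilinear_adjacent[OF \<delta>G[OF I, of ?xs ?us], of "nths (map pG pre) ({..<n} - I)"
              "nths (map pG post) {j. Suc (Suc (j + ?p)) \<in> {..<n} - I}" "pG a"] lens(2) len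
          unfolding decG by simp
      qed
      then show ?thesis by simp
    qed
    have swap: "?st (insert (Suc ?p) (I - {?p})) = - ?st I" if "I \<in> S" for I
    proof -
      let ?I' = "insert (Suc ?p) (I - {?p})"
      have I: "I \<subseteq> {..<n}" "finite I" "?p \<in> I" "Suc ?p \<notin> I"
        using that finite_subset by (auto simp: S_def)
      have "card ?I' = card I"
        using I by (metis DiffD1 card_insert_disjoint card_Suc_Diff1 finite_Diff)
      moreover have "nths ?us ?I' = nths ?us I"
      proof -
        have "nths (map pV pre) ?I' = nths (map pV pre) I"
          by (rule nths_cong) auto
        moreover have "{j. Suc (Suc (j + ?p)) \<in> ?I'} = {j. Suc (Suc (j + ?p)) \<in> I}" by auto
        ultimately show ?thesis unfolding decV using I by simp
      qed
      moreover have "nths ?xs ({..<n} - ?I') = nths ?xs ({..<n} - I)"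
      proof -
        have "nths (map pG pre) ({..<n} - ?I') = nths (map pG pre) ({..<n} - I)"
          by (rule nths_cong) auto
        moreover have "{j. Suc (Suc (j + ?p)) \<in> {..<n} - ?I'} = {j. Suc (Suc (j + ?p)) \<in> {..<n} - I}"
          by auto
        ultimately show ?thesis unfolding decG using I len by auto
      qed
      ultimately show ?thesis
        using shuffle_exponent_shift[OF I(2-4)] by simp
    qed
    have "signed_sum sW n \<delta> ?xs ?us = sum ?st (S \<union> T)"
      unfolding signed_sum_def using zero
      by (intro sum.mono_neutral_right) (auto simp: S_def T_def)
    also have "\<dots> = sum ?st S + sum ?st T"
      by (intro sum.union_disjoint) (auto simp: S_def T_def)
    also have "sum ?st T = (\<Sum>I\<in>S. ?st (insert (Suc ?p) (I - {?p})))"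
      by (rule sum.reindex_bij_betw[symmetric], rule bij_betw_byWitness[where f' = "\<lambda>I. insert ?p (I - {Suc ?p})"])
        (use len in \<open>auto simp: S_def T_def\<close>)
    also have "\<dots> = (\<Sum>I\<in>S. - ?st I)" by (rule sum.cong[OF refl swap])
    finally show "signed_sum sW n \<delta> ?xs ?us = 0" by (simp add: sum_negf)
  }
qed

section \<open>Composition and transfer\<close>

lemma alt_multilinear_cong:
  assumes "\<And>xs. length xs = m \<Longrightarrow> f xs = f' xs"
  shows "alt_multilinear s t m f \<longleftrightarrow> alt_multilinear s t m f'"
  using assms unfolding alt_multilinear_def by simp

lemma linear_plus:
  assumes "Vector_Spaces.linear s t f" "Vector_Spaces.linear s t g"
  shows "Vector_Spaces.linear s t (\<lambda>x. f x + g x)"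
  using assms
  by (simp add: Vector_Spaces.linear_iff vector_space.vector_space_assms(1) add.assoc add.left_commute)

lemma alt_multilinear_plus:
  assumes "alt_multilinear s t m f" "alt_multilinear s t m g"
  shows "alt_multilinear s t m (\<lambda>xs. f xs + g xs)"
  unfolding alt_multilinear_def
proof (intro conjI allI impI)
  fix xs :: "'b list" and i assume i: "length xs = m" "i < m"
  then have "Vector_Spaces.linear s t (\<lambda>y. f (xs[i := y]))"
    and "Vector_Spaces.linear s t (\<lambda>y. g (xs[i := y]))"
    using assms by (auto simp: alt_multilinear_def)
  then show "Vector_Spaces.linear s t (\<lambda>y. f (xs[i := y]) + g (xs[i := y]))"
    by (rule linear_plus)
next
  fix xs :: "'b list" and i j
  assume "length xs = m" "i < j" "j < m" "xs ! i = xs ! j"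
  then have "f xs = 0" "g xs = 0" using assms unfolding alt_multilinear_def by blast+
  then show "f xs + g xs = 0" by simp
qed

lemma linear_at_zero:
  assumes "Vector_Spaces.linear s t h"
  shows "h 0 = 0"
proof -
  have "h (0 + 0) = h 0 + h 0" using assms unfolding Vector_Spaces.linear_iff by blast
  then show ?thesis by simp
qed

lemma alt_multilinear_after:
  assumes "alt_multilinear s t m f" "Vector_Spaces.linear t t' h"
  shows "alt_multilinear s t' m (\<lambda>xs. h (f xs))"
  unfolding alt_multilinear_def
proof (intro conjI allI impI)
  fix xs :: "'b list" and i assume "length xs = m" "i < m"
  then have "Vector_Spaces.linear s t (\<lambda>y. f (xs[i := y]))"
    using assms(1) by (simp add: alt_multilinear_def)
  then show "Vector_Spaces.linear s t' (\<lambda>y. h (f (xs[i := y])))"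
    using assms(2) by (rule linear_after_linear)
next
  fix xs :: "'b list" and i j
  assume "length xs = m" "i < j" "j < m" "xs ! i = xs ! j"
  then have "f xs = 0" using assms(1) unfolding alt_multilinear_def by blast
  then show "h (f xs) = 0" by (simp add: linear_at_zero[OF assms(2)])
qed

lemma alt_multilinear_block:
  fixes i :: "'u::ab_group_add \<Rightarrow> 'e::ab_group_add"
  assumes F: "alt_multilinear sE sW n F" and i: "Vector_Spaces.linear sU sE i"
    and len: "length A + m + length C = n"
  shows "alt_multilinear sU sW m (\<lambda>us. F (A @ map i us @ C))"
  unfolding alt_multilinear_iff_adjacent
proof (intro conjI allI impI)
  fix pre post :: "'u list" assume "length pre + length post + 1 = m"
  then show "Vector_Spaces.linear sU sW (\<lambda>y. F (A @ map i (pre @ y # post) @ C))"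
    using linear_after_linear[OF i alt_multilinear_slot[OF F, of "A @ map i pre" "map i post @ C"]] len
    by simp
next
  fix pre post :: "'u list" and a assume "length pre + length post + 2 = m"
  then show "F (A @ map i (pre @ a # a # post) @ C) = 0"
    using alt_multilinear_adjacent[OF F, of "A @ map i pre" "map i post @ C" "i a"] len by simp
qed

text \<open>
  The identity involves only addition and the bracket, so it passes along any additive surjection
  which respects the brackets. This is applied to \<open>\<gg> \<times> V \<rightarrow> E\<close> and to its inverse.
\<close>

lemma filippov_transfer:
  fixes J :: "'a::ab_group_add \<Rightarrow> 'b::ab_group_add"
  assumes add: "\<And>x y. J (x + y) = J x + J y" and "surj J" and "n \<ge> 1"
    and B: "\<And>ps. length ps = n \<Longrightarrow> B' (map J ps) = J (B ps)"
    and fil: "filippov n B"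
  shows "filippov n B'"
  unfolding filippov_def
proof (intro allI impI)
  fix zs ws :: "'b list" assume len: "length zs = n - 1" "length ws = n"
  obtain zs' ws' where zw: "zs = map J zs'" "ws = map J ws'"
    using \<open>surj J\<close> by (metis ex_map_conv surjD)
  have J0: "J 0 = 0" by (metis add add_cancel_left_left)
  have "B' (zs @ [B' ws]) = B' (map J (zs' @ [B ws']))"
    using B[of ws'] len zw by simp
  also have "\<dots> = J (B (zs' @ [B ws']))"
    using B[of "zs' @ [B ws']"] len zw \<open>n \<ge> 1\<close> by simp
  also have "\<dots> = J (\<Sum>i<n. B (ws'[i := B (zs' @ [ws' ! i])]))"
    using fil len zw by (simp add: filippov_def)
  also have "\<dots> = (\<Sum>i<n. J (B (ws'[i := B (zs' @ [ws' ! i])])))"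
    using sum_comp_morphism[of J, OF J0 add, symmetric] by (simp add: comp_def)
  also have "\<dots> = (\<Sum>i<n. B' (ws[i := B' (zs @ [ws ! i])]))"
  proof (rule sum.cong[OF refl])
    fix i assume "i \<in> {..<n}"
    then have "B' (zs @ [ws ! i]) = J (B (zs' @ [ws' ! i]))"
      using B[of "zs' @ [ws' ! i]"] len zw \<open>n \<ge> 1\<close> by simp
    then show "J (B (ws'[i := B (zs' @ [ws' ! i])])) = B' (ws[i := B' (zs @ [ws ! i])])"
      using B[of "ws'[i := B (zs' @ [ws' ! i])]"] len zw by (simp add: map_update)
  qed
  finally show "B' (zs @ [B' ws]) = (\<Sum>i<n. B' (ws[i := B' (zs @ [ws ! i])]))" .
qed

lemma map2_map_map: "map2 f (map g xs) (map h xs) = map (\<lambda>x. f (g x) (h x)) xs"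
  by (induction xs) auto

section \<open>Brackets on a direct sum\<close>

locale complement =
  fixes sG :: "'k::field \<Rightarrow> 'g::ab_group_add \<Rightarrow> 'g"
    and sV :: "'k \<Rightarrow> 'v::ab_group_add \<Rightarrow> 'v"
    and sE :: "'k \<Rightarrow> 'e::ab_group_add \<Rightarrow> 'e"
    and iG :: "'g \<Rightarrow> 'e" and iV :: "'v \<Rightarrow> 'e"
  assumes direct_sum: "direct_sum sG sV sE iG iV"
begin

definition prG :: "'e \<Rightarrow> 'g" where "prG e = fst (components iG iV e)"
definition prV :: "'e \<Rightarrow> 'v" where "prV e = snd (components iG iV e)"

lemma linear_iG: "Vector_Spaces.linear sG sE iG" and linear_iV: "Vector_Spaces.linear sV sE iV"
  using direct_sum by (auto simp: direct_sum_def)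

lemma vector_spaces: "vector_space sG" "vector_space sV" "vector_space sE"
  using linear_iG linear_iV by (auto simp: Vector_Spaces.linear_iff)

lemma iG_add: "iG (x + y) = iG x + iG y" and iV_add: "iV (u + v) = iV u + iV v"
  using linear_iG linear_iV by (auto simp: Vector_Spaces.linear_iff)

lemma iG_0 [simp]: "iG 0 = 0" and iV_0 [simp]: "iV 0 = 0"
  using iG_add[of 0 0] iV_add[of 0 0] by auto

lemma bij_sum: "bij (\<lambda>(x, u). iG x + iV u)"
  using direct_sum by (auto simp: direct_sum_def)

lemma components_sum: "components iG iV (iG x + iV u) = (x, u)"
  unfolding components_def using inv_f_f[OF bij_is_inj[OF bij_sum], of "(x, u)"] by simp

lemma pr_sum [simp]: "prG (iG x + iV u) = x" "prV (iG x + iV u) = u"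
  by (simp_all add: prG_def prV_def components_sum)

lemma pr_inj [simp]: "prG (iG x) = x" "prV (iG x) = 0" "prG (iV u) = 0" "prV (iV u) = u"
  using pr_sum[of x 0] pr_sum[of 0 u] by auto

lemma decompose: "iG (prG e) + iV (prV e) = e"
  using surj_f_inv_f[OF bij_is_surj[OF bij_sum], of e]
  by (simp add: prG_def prV_def components_def case_prod_unfold)

lemma sum_eq_iff: "iG x + iV u = iG y + iV v \<longleftrightarrow> x = y \<and> u = v"
  by (metis pr_sum)

lemma linear_prG: "Vector_Spaces.linear sE sG prG" and linear_prV: "Vector_Spaces.linear sE sV prV"
proof -
  have "e + e' = iG (prG e + prG e') + iV (prV e + prV e')" for e e'
  proof -
    have "e + e' = (iG (prG e) + iV (prV e)) + (iG (prG e') + iV (prV e'))"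
      by (simp only: decompose)
    then show ?thesis by (simp only: iG_add iV_add add.assoc add.left_commute)
  qed
  moreover have "sE c e = iG (sG c (prG e)) + iV (sV c (prV e))" for c e
  proof -
    have "sE c e = sE c (iG (prG e) + iV (prV e))" by (simp add: decompose)
    also have "\<dots> = sE c (iG (prG e)) + sE c (iV (prV e))"
      using vector_spaces(3) by (simp add: vector_space.vector_space_assms(1))
    finally show ?thesis
      using linear_iG linear_iV by (simp add: Vector_Spaces.linear_iff)
  qed
  ultimately have "prG (e + e') = prG e + prG e'" "prV (e + e') = prV e + prV e'"
    "prG (sE c e) = sG c (prG e)" "prV (sE c e) = sV c (prV e)" for c e e'
    by (metis pr_sum)+
  then show "Vector_Spaces.linear sE sG prG" "Vector_Spaces.linear sE sV prV"
    using vector_spaces by (auto simp: Vector_Spaces.linear_iff)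
qed

lemma pr_add [simp]: "prG (e + e') = prG e + prG e'" "prV (e + e') = prV e + prV e'"
  using linear_prG linear_prV by (auto simp: Vector_Spaces.linear_iff)

context
  fixes n :: nat and b :: "'g list \<Rightarrow> 'g"
  assumes n: "n \<ge> 2" and b: "n_Lie_algebra n sG b"
begin

abbreviation bracket_of :: "('g, 'v) datum \<Rightarrow> 'e list \<Rightarrow> 'e" where
  "bracket_of \<Gamma> \<equiv> full_bracket_on iG iV n sG sV b \<Gamma>"

abbreviation structures :: "('g, 'v) datum set" where
  "structures \<equiv> full_extending_structures n sG sV b"

lemma bracket_of_apply:
  assumes "length es = n"
  shows "bracket_of \<Gamma> es = iG (Gop sG n b \<Gamma> (map prG es) (map prV es))
    + iV (Hop sV n \<Gamma> (map prG es) (map prV es))"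
  using assms
  by (simp add: full_bracket_on_def full_bracket_def comp_def prG_def[abs_def] prV_def[abs_def])

lemma bialternating_of_datum:
  assumes "full_extending_datum n sG sV \<Gamma>"
  shows "bialternating_family n sG sV sG (with_degree_zero b (fst \<Gamma>))"
    and "bialternating_family n sG sV sV (with_degree_zero (\<lambda>_. 0) (snd \<Gamma>))"
proof -
  have "alt_multilinear sG sG n b" using b by (simp add: n_Lie_algebra_def)
  moreover have "alt_multilinear sG sV n (\<lambda>_. 0)"
    using vector_spaces
    by (simp add: alt_multilinear_def Vector_Spaces.linear_iff module.scale_zero_right
        module_iff_vector_space)
  ultimately show "bialternating_family n sG sV sG (with_degree_zero b (fst \<Gamma>))"
    "bialternating_family n sG sV sV (with_degree_zero (\<lambda>_. 0) (snd \<Gamma>))"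
    using assms by (auto simp: full_extending_datum_def intro: bialternating_with_degree_zero)
qed

lemma alt_multilinear_bracket_of:
  assumes "full_extending_datum n sG sV \<Gamma>"
  shows "alt_multilinear sE sE n (bracket_of \<Gamma>)"
proof -
  note \<delta> = bialternating_of_datum[OF assms]
  have "alt_multilinear sE sE n (\<lambda>es.
      iG (signed_sum sG n (with_degree_zero b (fst \<Gamma>)) (map prG es) (map prV es))
    + iV (signed_sum sV n (with_degree_zero (\<lambda>_. 0) (snd \<Gamma>)) (map prG es) (map prV es)))"
    using vector_spaces linear_prG linear_prV
    by (intro alt_multilinear_plus
        alt_multilinear_after[OF alt_multilinear_signed_sum[OF \<delta>(1)] linear_iG]
        alt_multilinear_after[OF alt_multilinear_signed_sum[OF \<delta>(2)] linear_iV])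
  then show ?thesis
    by (subst alt_multilinear_cong)
      (auto simp: bracket_of_apply Gop_def Hop_def shuffle_sum_eq_signed_sum)
qed

lemma bracket_of_sorted:
  assumes "full_extending_datum n sG sV \<Gamma>" and len: "length us + length xs = n"
  shows "bracket_of \<Gamma> (map iV us @ map iG xs)
    = iG (with_degree_zero b (fst \<Gamma>) (length us) us xs)
    + iV (with_degree_zero (\<lambda>_. 0) (snd \<Gamma>) (length us) us xs)"
proof -
  note \<delta> = bialternating_of_datum[OF assms(1)]
  have "map prG (map iV us @ map iG xs) = replicate (length us) 0 @ xs"
    "map prV (map iV us @ map iG xs) = us @ replicate (n - length us) 0"
    using len by (auto simp: comp_def map_replicate_const)
  then show ?thesis
    using len signed_sum_sorted[OF vector_spaces(1) \<delta>(1), of us "length us" xs]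
      signed_sum_sorted[OF vector_spaces(2) \<delta>(2), of us "length us" xs]
    by (simp add: bracket_of_apply Gop_def Hop_def shuffle_sum_eq_signed_sum)
qed

lemma bracket_of_pair:
  assumes "length ps = n"
  shows "bracket_of \<Gamma> (map (\<lambda>(x, u). iG x + iV u) ps)
    = (\<lambda>(x, u). iG x + iV u) (full_bracket n sG sV b \<Gamma> ps)"
proof -
  have "components iG iV \<circ> (\<lambda>(x, u). iG x + iV u) = id"
    by (auto simp: fun_eq_iff components_sum)
  then show ?thesis using assms by (simp add: full_bracket_on_def)
qed

lemma full_bracket_components:
  assumes "length es = n"
  shows "full_bracket n sG sV b \<Gamma> (map (components iG iV) es)
    = components iG iV (bracket_of \<Gamma> es)"
  using assms by (simp add: full_bracket_on_def case_prod_unfold components_sum)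

lemma components_add: "components iG iV (e + e') = components iG iV e + components iG iV e'"
  using pr_add[of e e'] unfolding prG_def prV_def by (simp add: prod_eq_iff)

lemma surj_components: "surj (components iG iV)"
  by (metis components_sum surj_def surj_pair)

lemma filippov_bracket_of: "filippov n (bracket_of \<Gamma>) \<longleftrightarrow> filippov n (full_bracket n sG sV b \<Gamma>)"
proof
  assume "filippov n (bracket_of \<Gamma>)"
  then show "filippov n (full_bracket n sG sV b \<Gamma>)"
    using n by (intro filippov_transfer[of "components iG iV" n _ "bracket_of \<Gamma>"])
      (auto simp: components_add surj_components full_bracket_components)
next
  assume "filippov n (full_bracket n sG sV b \<Gamma>)"
  then show "filippov n (bracket_of \<Gamma>)"
    using n bij_is_surj[OF bij_sum] bracket_of_pair
    by (intro filippov_transfer[of "\<lambda>(x, u). iG x + iV u" n _ "full_bracket n sG sV b \<Gamma>"])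
      (auto simp: iG_add iV_add algebra_simps)
qed

lemma bracket_of_extends:
  assumes "\<Gamma> \<in> structures"
  shows "bracket_of \<Gamma> \<in> extending_brackets n sE iG b"
proof -
  have \<Gamma>: "full_extending_datum n sG sV \<Gamma>" "filippov n (full_bracket n sG sV b \<Gamma>)"
    using assms by (auto simp: full_extending_structures_def)
  have "bracket_of \<Gamma> (map iG xs) = iG (b xs)" if "length xs = n" for xs
    using bracket_of_sorted[OF \<Gamma>(1), of "[]" xs] that by (simp add: with_degree_zero_def)
  moreover have "bracket_of \<Gamma> \<in> extensional {es. length es = n}"
    by (simp add: full_bracket_on_def)
  ultimately show ?thesis
    using \<Gamma> vector_spaces
    by (simp add: extending_brackets_def n_Lie_algebra_def alt_multilinear_bracket_of filippov_bracket_of)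
qed

definition datum_part :: "('e \<Rightarrow> 'w) \<Rightarrow> ('e list \<Rightarrow> 'e) \<Rightarrow> nat \<Rightarrow> 'v list \<Rightarrow> 'g list \<Rightarrow> 'w" where
  "datum_part p B k us xs =
     (if k \<in> {1..n} \<and> length us = k \<and> length xs = n - k then p (B (map iV us @ map iG xs))
      else undefined)"

lemma datum_family_datum_part:
  assumes B: "alt_multilinear sE sE n B" and p: "Vector_Spaces.linear sE sW p"
  shows "datum_family n sG sV sW (datum_part p B)"
  unfolding datum_family_def
proof (intro conjI ballI allI impI)
  fix k and xs :: "'g list" assume k: "k \<in> {1..n}" and len: "length xs = n - k"
  have "alt_multilinear sV sW k (\<lambda>us. p (B ([] @ map iV us @ map iG xs)))"
    using k len by (intro alt_multilinear_after[OF alt_multilinear_block[OF B linear_iV] p]) simp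
  then show "alt_multilinear sV sW k (\<lambda>us. datum_part p B k us xs)"
    by (subst alt_multilinear_cong) (use k len in \<open>auto simp: datum_part_def\<close>)
next
  fix k and us :: "'v list" assume k: "k \<in> {1..n}" and len: "length us = k"
  have "alt_multilinear sG sW (n - k) (\<lambda>xs. p (B (map iV us @ map iG xs @ [])))"
    using k len by (intro alt_multilinear_after[OF alt_multilinear_block[OF B linear_iG] p]) simp
  then show "alt_multilinear sG sW (n - k) (\<lambda>xs. datum_part p B k us xs)"
    by (subst alt_multilinear_cong) (use k len in \<open>auto simp: datum_part_def\<close>)
qed (auto simp: datum_part_def)

text \<open>
  The component of degree \<open>0\<close> is not part of the datum; there the agreement with \<open>B\<close> is the
  hypothesis that \<open>B\<close> extends the bracket of \<open>\<gg>\<close>.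
\<close>

lemma bracket_of_surj:
  assumes "B \<in> extending_brackets n sE iG b"
  shows "\<exists>\<Gamma>\<in>structures. bracket_of \<Gamma> = B"
proof -
  have B: "B \<in> extensional {es. length es = n}" "alt_multilinear sE sE n B" "filippov n B"
    "\<And>xs. length xs = n \<Longrightarrow> B (map iG xs) = iG (b xs)"
    using assms by (auto simp: extending_brackets_def n_Lie_algebra_def)
  define \<Gamma> where "\<Gamma> = (datum_part prG B, datum_part prV B)"
  have \<Gamma>: "full_extending_datum n sG sV \<Gamma>"
    using datum_family_datum_part[OF B(2) linear_prG] datum_family_datum_part[OF B(2) linear_prV]
    by (simp add: full_extending_datum_def \<Gamma>_def)
  have "bracket_of \<Gamma> es = B es" if "length es = n" for es
  proof (rule alt_multilinear_eq_if_eq_on_sorted[OF alt_multilinear_bracket_of[OF \<Gamma>] B(2) _ _ that])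
    show "\<exists>x u. e = iG x + iV u" for e using decompose by metis
  next
    fix us :: "'v list" and xs :: "'g list" assume len: "length us + length xs = n"
    show "bracket_of \<Gamma> (map iV us @ map iG xs) = B (map iV us @ map iG xs)"
    proof (cases us)
      case Nil
      then show ?thesis
        using len B(4) bracket_of_sorted[OF \<Gamma> len] by (simp add: with_degree_zero_def)
    next
      case (Cons u us')
      then have "length us \<in> {1..n}" "length us \<noteq> 0" "length xs = n - length us" using len by auto
      then show ?thesis
        using bracket_of_sorted[OF \<Gamma> len]
        by (simp add: with_degree_zero_def \<Gamma>_def datum_part_def decompose Suc_le_eq)
    qed
  qed
  then have "bracket_of \<Gamma> = B"
    using B(1) by (intro extensionalityI[of _ "{es. length es = n}"]) (auto simp: full_bracket_on_def)
  moreover from this have "\<Gamma> \<in> structures"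
    using \<Gamma> B(3) filippov_bracket_of[of \<Gamma>] by (simp add: full_extending_structures_def)
  ultimately show ?thesis by blast
qed

section \<open>Isomorphisms fixing \<open>\<gg>\<close>\<close>

definition shear :: "('v \<Rightarrow> 'g) \<Rightarrow> ('v \<Rightarrow> 'v) \<Rightarrow> 'e \<Rightarrow> 'e" where
  "shear r s e = iG (prG e + r (prV e)) + iV (s (prV e))"

lemma intertwines_iff_shear:
  "intertwines n sG sV b r s \<Gamma> \<Lambda> \<longleftrightarrow>
     (\<forall>es. length es = n \<longrightarrow> shear r s (bracket_of \<Gamma> es) = bracket_of \<Lambda> (map (shear r s) es))"
proof -
  let ?P = "\<lambda>xs us. Gop sG n b \<Gamma> xs us + r (Hop sV n \<Gamma> xs us)
          = Gop sG n b \<Lambda> (map2 (\<lambda>x u. x + r u) xs us) (map s us) \<and>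
        s (Hop sV n \<Gamma> xs us) = Hop sV n \<Lambda> (map2 (\<lambda>x u. x + r u) xs us) (map s us)"
  have key: "shear r s (bracket_of \<Gamma> es) = bracket_of \<Lambda> (map (shear r s) es)
      \<longleftrightarrow> ?P (map prG es) (map prV es)" if "length es = n" for es
  proof -
    have "map prG (map (shear r s) es) = map2 (\<lambda>x u. x + r u) (map prG es) (map prV es)"
      "map prV (map (shear r s) es) = map s (map prV es)"
      by (auto simp: map2_map_map shear_def)
    then show ?thesis
      using that bracket_of_apply[of es \<Gamma>] bracket_of_apply[of "map (shear r s) es" \<Lambda>]
      by (simp add: shear_def sum_eq_iff del: map_map)
  qed
  show ?thesis
    unfolding intertwines_def
  proof (intro iffI allI impI)
    fix es :: "'e list" assume "\<forall>xs us. length xs = n \<longrightarrow> length us = n \<longrightarrow> ?P xs us" "length es = n"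
    then show "shear r s (bracket_of \<Gamma> es) = bracket_of \<Lambda> (map (shear r s) es)"
      by (subst key) simp_all
  next
    fix xs :: "'g list" and us :: "'v list"
    assume *: "\<forall>es. length es = n \<longrightarrow>
        shear r s (bracket_of \<Gamma> es) = bracket_of \<Lambda> (map (shear r s) es)"
      and len: "length xs = n" "length us = n"
    define es where "es = map2 (\<lambda>x u. iG x + iV u) xs us"
    have "map prG es = xs" "map prV es = us" "length es = n"
      using len by (auto simp: es_def list_eq_iff_nth_eq)
    with key[of es] * show "?P xs us" by metis
  qed
qed

lemma shear_iG: "Vector_Spaces.linear sV sG r \<Longrightarrow> Vector_Spaces.linear sV sV s \<Longrightarrow> shear r s (iG x) = iG x"
  by (simp add: shear_def linear_at_zero)

lemma linear_shear:
  assumes r: "Vector_Spaces.linear sV sG r" and s: "Vector_Spaces.linear sV sV s"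
  shows "Vector_Spaces.linear sE sE (shear r s)"
proof -
  have "Vector_Spaces.linear sE sE (\<lambda>e. iG (prG e))"
    "Vector_Spaces.linear sE sE (\<lambda>e. iG (r (prV e)))"
    "Vector_Spaces.linear sE sE (\<lambda>e. iV (s (prV e)))"
    using linear_prG linear_prV linear_iG linear_iV r s
    by (auto intro: linear_after_linear[OF linear_after_linear] linear_after_linear)
  then have "Vector_Spaces.linear sE sE (\<lambda>e. iG (prG e) + iG (r (prV e)) + iV (s (prV e)))"
    by (intro linear_plus)
  then show ?thesis by (simp add: shear_def[abs_def] iG_add)
qed

lemma n_Lie_iso_shear:
  assumes r: "Vector_Spaces.linear sV sG r" and s: "Vector_Spaces.linear sV sV s" "bij s"
    and "intertwines n sG sV b r s \<Gamma> \<Lambda>"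
  shows "n_Lie_iso n sE (bracket_of \<Gamma>) (bracket_of \<Lambda>) (shear r s)"
proof -
  have "bij (shear r s)"
  proof (rule o_bij)
    \<comment> \<open>Solve \<open>x + r(u) + s(u) = y + v\<close> for \<open>u\<close> first, then for \<open>x\<close>.\<close>
    let ?g = "\<lambda>e. iG (prG e - r (inv s (prV e))) + iV (inv s (prV e))"
    show "?g \<circ> shear r s = id" "shear r s \<circ> ?g = id"
      using \<open>bij s\<close> by (auto simp: shear_def fun_eq_iff decompose bij_is_inj bij_is_surj surj_f_inv_f)
  qed
  then show ?thesis
    using assms linear_shear by (simp add: n_Lie_iso_def intertwines_iff_shear)
qed

text \<open>
  The maps \<open>r\<close> and \<open>s\<close> are the components of \<open>\<phi>\<close> restricted to \<open>V\<close>. Injectivity of \<open>s\<close>: if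
  \<open>s u = s v\<close> then \<open>\<phi>\<close> agrees on \<open>r v + u\<close> and \<open>r u + v\<close>, so \<open>u = v\<close>.
\<close>

lemma iso_fixing_is_shear:
  assumes iso: "n_Lie_iso n sE (bracket_of \<Gamma>) (bracket_of \<Lambda>) \<phi>" and fix_g: "\<And>x. \<phi> (iG x) = iG x"
  obtains r s where "Vector_Spaces.linear sV sG r" "Vector_Spaces.linear sV sV s" "bij s"
    "intertwines n sG sV b r s \<Gamma> \<Lambda>" "\<phi> = shear r s"
proof
  define r s where "r = (\<lambda>u. prG (\<phi> (iV u)))" and "s = (\<lambda>u. prV (\<phi> (iV u)))"
  have lin: "Vector_Spaces.linear sE sE \<phi>" and bij: "bij \<phi>"
    using iso by (auto simp: n_Lie_iso_def)
  have add: "\<phi> (e + e') = \<phi> e + \<phi> e'" for e e'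
    using lin by (simp add: Vector_Spaces.linear_iff)
  show linr: "Vector_Spaces.linear sV sG r" and lins: "Vector_Spaces.linear sV sV s"
    unfolding r_def s_def
    using linear_after_linear[OF linear_after_linear[OF linear_iV lin]] linear_prG linear_prV by auto
  show \<phi>: "\<phi> = shear r s"
  proof
    fix e
    have "\<phi> e = iG (prG e) + \<phi> (iV (prV e))"
      using add[of "iG (prG e)" "iV (prV e)"] by (simp add: decompose fix_g)
    also have "\<phi> (iV (prV e)) = iG (r (prV e)) + iV (s (prV e))"
      by (simp add: r_def s_def decompose)
    finally show "\<phi> e = shear r s e" by (simp add: shear_def iG_add add.assoc)
  qed
  show "bij s"
  proof (rule bijI)
    show "inj s"
    proof (rule injI)
      fix u v assume "s u = s v"
      then have "\<phi> (iG (r v) + iV u) = \<phi> (iG (r u) + iV v)"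
        by (simp add: \<phi> shear_def add.commute)
      then show "u = v" using bij by (simp add: bij_def inj_eq sum_eq_iff)
    qed
    show "surj s"
    proof (rule surjI)
      fix v
      have "\<phi> (inv \<phi> (iV v)) = iV v" using bij by (simp add: bij_is_surj surj_f_inv_f)
      then show "s (prV (inv \<phi> (iV v))) = v" by (metis \<phi> pr_inj(4) pr_sum(2) shear_def)
    qed
  qed
  show "intertwines n sG sV b r s \<Gamma> \<Lambda>"
    using iso by (simp add: intertwines_iff_shear \<phi> n_Lie_iso_def)
qed

lemma struct_equiv_eq:
  "struct_equiv n sG sV b = {(\<Gamma>, \<Lambda>). \<Gamma> \<in> structures \<and> \<Lambda> \<in> structures \<and>
     (bracket_of \<Gamma>, bracket_of \<Lambda>) \<in> ext_equiv n sE iG b}"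
proof -
  have "(\<exists>r s. Vector_Spaces.linear sV sG r \<and> Vector_Spaces.linear sV sV s \<and> bij s \<and>
               intertwines n sG sV b r s \<Gamma> \<Lambda>) \<longleftrightarrow>
    (\<exists>\<phi>. n_Lie_iso n sE (bracket_of \<Gamma>) (bracket_of \<Lambda>) \<phi> \<and> (\<forall>x. \<phi> (iG x) = iG x))" for \<Gamma> \<Lambda>
    by (metis iso_fixing_is_shear n_Lie_iso_shear shear_iG)
  then show ?thesis
    unfolding struct_equiv_def ext_equiv_def by (auto simp: bracket_of_extends)
qed

lemma shear_moves_in_g_iff:
  "(\<forall>e. shear r s e - e \<in> range iG) \<longleftrightarrow> s = id"
proof -
  have eq: "shear r s e - e = iG (r (prV e)) + (iV (s (prV e)) - iV (prV e))" for e
    using decompose[of e] by (simp add: shear_def iG_add algebra_simps)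
  show ?thesis
  proof
    assume *: "\<forall>e. shear r s e - e \<in> range iG"
    have "s u = u" for u
    proof -
      obtain x where "shear r s (iV u) - iV u = iG x" using * by blast
      then have "iG (r u) + iV (s u) = iG x + iV u" by (simp add: shear_def algebra_simps)
      then show ?thesis by (simp add: sum_eq_iff)
    qed
    then show "s = id" by auto
  qed (use eq in auto)
qed

lemma struct_coequiv_eq:
  "struct_coequiv n sG sV b = {(\<Gamma>, \<Lambda>). \<Gamma> \<in> structures \<and> \<Lambda> \<in> structures \<and>
     (bracket_of \<Gamma>, bracket_of \<Lambda>) \<in> ext_coequiv n sE iG b}"
proof -
  have "(\<exists>r. Vector_Spaces.linear sV sG r \<and> intertwines n sG sV b r id \<Gamma> \<Lambda>) \<longleftrightarrow>
    (\<exists>\<phi>. n_Lie_iso n sE (bracket_of \<Gamma>) (bracket_of \<Lambda>) \<phi> \<and> (\<forall>x. \<phi> (iG x) = iG x) \<and>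
       (\<forall>e. \<phi> e - e \<in> range iG))" (is "?L \<longleftrightarrow> ?R") for \<Gamma> \<Lambda>
  proof
    assume ?L
    then obtain r where r: "Vector_Spaces.linear sV sG r" "intertwines n sG sV b r id \<Gamma> \<Lambda>" by blast
    have id: "Vector_Spaces.linear sV sV id" "bij (id :: 'v \<Rightarrow> 'v)"
      using vector_spaces by (auto simp: Vector_Spaces.linear_iff)
    show ?R
      using n_Lie_iso_shear[OF r(1) id r(2)] shear_iG[OF r(1) id(1)] shear_moves_in_g_iff[of r id]
      by (intro exI[of _ "shear r id"]) auto
  next
    assume ?R
    then show ?L by (metis iso_fixing_is_shear shear_moves_in_g_iff)
  qed
  then show ?thesis
    unfolding struct_coequiv_def ext_coequiv_def by (auto simp: bracket_of_extends)
qed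

end

end

section \<open>Passing to quotients\<close>

lemma n_Lie_iso_id: "vector_space sE \<Longrightarrow> n_Lie_iso n sE B B id"
  by (simp add: n_Lie_iso_def Vector_Spaces.linear_iff)

lemma n_Lie_iso_inv:
  assumes "n_Lie_iso n sE B B' \<phi>"
  shows "n_Lie_iso n sE B' B (inv \<phi>)"
proof -
  have lin: "Vector_Spaces.linear sE sE \<phi>" and bij: "bij \<phi>"
    and hom: "\<And>es. length es = n \<Longrightarrow> \<phi> (B es) = B' (map \<phi> es)"
    using assms by (auto simp: n_Lie_iso_def)
  have [simp]: "\<phi> (inv \<phi> e) = e" "inv \<phi> (\<phi> e) = e" for e
    using bij by (simp_all add: bij_is_inj bij_is_surj surj_f_inv_f)
  have "inv \<phi> (e + e') = inv \<phi> e + inv \<phi> e'" "inv \<phi> (sE c e) = sE c (inv \<phi> e)" for e e' c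
    using lin bij by (auto simp: Vector_Spaces.linear_iff intro!: inv_f_eq bij_is_inj)
  moreover have "inv \<phi> (B' es) = B (map (inv \<phi>) es)" if "length es = n" for es
    using that bij hom[of "map (inv \<phi>) es"] by (auto simp: comp_def intro!: inv_f_eq bij_is_inj)
  ultimately show ?thesis
    using lin bij by (simp add: n_Lie_iso_def Vector_Spaces.linear_iff bij_imp_bij_inv)
qed

lemma n_Lie_iso_comp:
  assumes "n_Lie_iso n sE B B' \<phi>" "n_Lie_iso n sE B' B'' \<psi>"
  shows "n_Lie_iso n sE B B'' (\<psi> \<circ> \<phi>)"
  using assms by (auto simp: n_Lie_iso_def bij_comp Vector_Spaces.linear_iff)

text \<open>
  Covers both relations on brackets: \<open>P\<close> says which isomorphisms are admitted.
\<close>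

lemma equiv_by_isomorphisms:
  assumes id: "P id" and inv: "\<And>\<phi>. bij \<phi> \<Longrightarrow> P \<phi> \<Longrightarrow> P (inv \<phi>)"
    and comp: "\<And>\<phi> \<psi>. P \<phi> \<Longrightarrow> P \<psi> \<Longrightarrow> P (\<psi> \<circ> \<phi>)" and "vector_space sE"
  shows "equiv X {(B, B'). B \<in> X \<and> B' \<in> X \<and> (\<exists>\<phi>. n_Lie_iso n sE B B' \<phi> \<and> P \<phi>)}" (is "equiv X ?R")
proof (rule equivI)
  show "refl_on X ?R" using id n_Lie_iso_id[OF \<open>vector_space sE\<close>] by (auto simp: refl_on_def)
  show "sym ?R"
  proof (rule symI)
    fix B B' assume "(B, B') \<in> ?R"
    then obtain \<phi> where "B \<in> X" "B' \<in> X" "n_Lie_iso n sE B B' \<phi>" "P \<phi>" by blast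
    moreover from this have "bij \<phi>" by (simp add: n_Lie_iso_def)
    ultimately show "(B', B) \<in> ?R" using n_Lie_iso_inv inv by blast
  qed
  show "trans ?R"
  proof (rule transI)
    fix B B' B'' assume "(B, B') \<in> ?R" "(B', B'') \<in> ?R"
    then show "(B, B'') \<in> ?R" using n_Lie_iso_comp comp by blast
  qed
qed auto

lemma equiv_ext_equiv:
  assumes "vector_space sE"
  shows "equiv (extending_brackets n sE iG b) (ext_equiv n sE iG b)"
  unfolding ext_equiv_def
proof (rule equiv_by_isomorphisms[OF _ _ _ assms])
  fix \<phi> assume "bij \<phi>" "\<forall>x. \<phi> (iG x) = iG x"
  then show "\<forall>x. inv \<phi> (iG x) = iG x" by (simp add: bij_is_inj inv_f_eq)
qed auto

lemma equiv_ext_coequiv: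
  fixes iG :: "'g::ab_group_add \<Rightarrow> 'e::ab_group_add"
  assumes "vector_space sE" and add: "\<And>x y. iG (x + y) = iG x + iG y"
  shows "equiv (extending_brackets n sE iG b) (ext_coequiv n sE iG b)"
  unfolding ext_coequiv_def
proof (rule equiv_by_isomorphisms[OF _ _ _ assms(1)])
  have zero: "iG 0 = 0" using add[of 0 0] by simp
  have minus: "iG (- x) = - iG x" for x
    using add[of "- x" x] zero by (simp add: eq_neg_iff_add_eq_0)
  show "(\<forall>x. id (iG x) = iG x) \<and> (\<forall>e. id e - e \<in> range iG)"
    using zero by (auto intro: rangeI[of iG 0, simplified zero])
  {
    fix \<phi> assume \<phi>: "bij \<phi>" "(\<forall>x. \<phi> (iG x) = iG x) \<and> (\<forall>e. \<phi> e - e \<in> range iG)"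
    have "inv \<phi> e - e \<in> range iG" for e
    proof -
      obtain x where "\<phi> (inv \<phi> e) - inv \<phi> e = iG x" using \<phi> by blast
      then have "inv \<phi> e - e = iG (- x)"
        using \<phi> by (simp add: minus bij_is_surj surj_f_inv_f algebra_simps)
      then show ?thesis by simp
    qed
    then show "(\<forall>x. inv \<phi> (iG x) = iG x) \<and> (\<forall>e. inv \<phi> e - e \<in> range iG)"
      using \<phi> by (simp add: bij_is_inj inv_f_eq)
  }
  fix \<phi> \<psi>
  assume \<phi>: "(\<forall>x. \<phi> (iG x) = iG x) \<and> (\<forall>e. \<phi> e - e \<in> range iG)"
    and \<psi>: "(\<forall>x. \<psi> (iG x) = iG x) \<and> (\<forall>e. \<psi> e - e \<in> range iG)"
  have "\<psi> (\<phi> e) - e \<in> range iG" for e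
  proof -
    obtain x y where "\<phi> e - e = iG x" "\<psi> (\<phi> e) - \<phi> e = iG y" using \<phi> \<psi> by blast
    then have "\<psi> (\<phi> e) - e = iG (y + x)" by (simp add: add algebra_simps)
    then show ?thesis by simp
  qed
  then show "(\<forall>x. (\<psi> \<circ> \<phi>) (iG x) = iG x) \<and> (\<forall>e. (\<psi> \<circ> \<phi>) e - e \<in> range iG)"
    using \<phi> \<psi> by simp
qed

text \<open>
  The induced map is injective because \<open>Q\<close> is pulled back, so that elements with related images
  are already related, and onto because \<open>f\<close> is.
\<close>

lemma quotient_bij_of_pullback:
  assumes R: "equiv B R" and f: "\<And>x. x \<in> A \<Longrightarrow> f x \<in> B" and surj: "\<And>y. y \<in> B \<Longrightarrow> \<exists>x\<in>A. f x = y"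
    and Q: "Q = {(x, y). x \<in> A \<and> y \<in> A \<and> (f x, f y) \<in> R}"
  shows "equiv A Q \<and> (\<exists>F. bij_betw F (A // Q) (B // R) \<and> (\<forall>x\<in>A. F (Q `` {x}) = R `` {f x}))"
proof
  show eqQ: "equiv A Q"
    using R f unfolding equiv_def Q refl_on_def sym_def trans_def by blast
  define F where "F = (\<lambda>C. R `` (f ` C))"
  have F: "F (Q `` {x}) = R `` {f x}" if "x \<in> A" for x
  proof
    show "F (Q `` {x}) \<subseteq> R `` {f x}"
      using R by (auto simp: F_def Q equiv_def dest: transD)
    show "R `` {f x} \<subseteq> F (Q `` {x})"
      using equiv_class_self[OF eqQ that] by (auto simp: F_def)
  qed
  have "inj_on F (A // Q)"
  proof (rule inj_onI)
    fix C D assume "C \<in> A // Q" "D \<in> A // Q" and eq: "F C = F D"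
    then obtain x y where xy: "x \<in> A" "C = Q `` {x}" "y \<in> A" "D = Q `` {y}"
      by (auto elim!: quotientE)
    then have "(f x, f y) \<in> R"
      using eq F eq_equiv_class_iff[OF R] f by metis
    then show "C = D" using xy equiv_class_eq[OF eqQ, of x y] by (simp add: Q)
  qed
  moreover have "F ` (A // Q) = B // R"
  proof
    show "F ` (A // Q) \<subseteq> B // R" using F f by (auto elim!: quotientE simp: quotientI)
    show "B // R \<subseteq> F ` (A // Q)"
    proof
      fix D assume "D \<in> B // R"
      then obtain x where "x \<in> A" "D = R `` {f x}" using surj by (metis quotientE)
      then show "D \<in> F ` (A // Q)" using F quotientI[of x A Q] by (metis imageI)
    qed
  qed
  ultimately show "\<exists>F. bij_betw F (A // Q) (B // R) \<and> (\<forall>x\<in>A. F (Q `` {x}) = R `` {f x})"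
    using F by (auto simp: bij_betw_def)
qed

theorem theoremA7:
  fixes n :: nat
    and sG :: "'k::field_char_0 \<Rightarrow> 'g::ab_group_add \<Rightarrow> 'g"
    and sV :: "'k \<Rightarrow> 'v::ab_group_add \<Rightarrow> 'v"
    and sE :: "'k \<Rightarrow> 'e::ab_group_add \<Rightarrow> 'e"
    and iG :: "'g \<Rightarrow> 'e" and iV :: "'v \<Rightarrow> 'e"
    and b :: "'g list \<Rightarrow> 'g"
  assumes "n \<ge> 2"
    and "n_Lie_algebra n sG b"
    and "vector_space sV" and "vector_space sE"
    and "direct_sum sG sV sE iG iV"
  shows
    "equiv (full_extending_structures n sG sV b) (struct_equiv n sG sV b) \<and>
     equiv (extending_brackets n sE iG b) (ext_equiv n sE iG b) \<and>
     (\<exists>F. bij_betw F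
            (full_extending_structures n sG sV b // struct_equiv n sG sV b)
            (Extd n sE iG b) \<and>
          (\<forall>\<Gamma> \<in> full_extending_structures n sG sV b.
             F (struct_equiv n sG sV b `` {\<Gamma>})
               = ext_equiv n sE iG b `` {full_bracket_on iG iV n sG sV b \<Gamma>})) \<and>
     equiv (full_extending_structures n sG sV b) (struct_coequiv n sG sV b) \<and>
     equiv (extending_brackets n sE iG b) (ext_coequiv n sE iG b) \<and>
     (\<exists>F. bij_betw F
            (full_extending_structures n sG sV b // struct_coequiv n sG sV b)
            (Extd' n sE iG b) \<and>
          (\<forall>\<Gamma> \<in> full_extending_structures n sG sV b.
             F (struct_coequiv n sG sV b `` {\<Gamma>})
               = ext_coequiv n sE iG b `` {full_bracket_on iG iV n sG sV b \<Gamma>}))"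
proof -
  interpret complement sG sV sE iG iV
    using assms(5) by unfold_locales
  note ctx = assms(1,2)
  note ext = equiv_ext_equiv[OF assms(4), of n iG b]
    and coext = equiv_ext_coequiv[OF assms(4) iG_add, of n b]
  show ?thesis
    using ext coext
      quotient_bij_of_pullback[OF ext bracket_of_extends[OF ctx] bracket_of_surj[OF ctx]
        struct_equiv_eq[OF ctx]]
      quotient_bij_of_pullback[OF coext bracket_of_extends[OF ctx] bracket_of_surj[OF ctx]
        struct_coequiv_eq[OF ctx]]
    unfolding Extd_def Extd'_def by blast
qed

end
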